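(* Let $p$ be an odd prime and $N=p-1$. Let $\vec v=(v_k)_{k=0}^N$ be the eigenvector of the $p\times p$ symmetric Pascal matrix $T_N$ with eigenvalue $1$, normalized by $v_N=1$, whose generating function is $$f(\vec v;z)=\sum_{k=0}^N v_kz^{N-k}={}_2F_1\!\left(-\tfrac N2,\tfrac N2+1;-N;z\right)\cdot {}_2F_1\!\left(-\tfrac N2,\tfrac N2+1;-N;\tfrac{z}{z-1}\right)(1-z)^{N/2}.$$ Then for all $z\in\mathbb{F}_p$ with $z\ne 0,1$, $$f(\vec v;z)=\sum_{k=0}^N v_kz^{N-k}\equiv\big(\#E_z(\mathbb{F}_p)-1\big)^2 \mod p,$$ where $\#E_z(\mathbb{F}_p)$ is the number of $\mathbb{F}_p$-points on the Legendre elliptic curve $E_z:\ y^2=x(x-1)(x-z)$.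
   Context: The symmetric Pascal matrix $T_N$ is the $(N+1)\times(N+1)$ matrix with entries $(T_N)_{j,k}=\binom{j+k}{j}$, $0\le j,k\le N$. For $N$ even, ${}_2F_1(-N/2,N/2+1;-N;x)=\sum_{k=0}^{N/2}\frac{(-N/2)_k(N/2+1)_k}{(-N)_k\,k!}x^k$, with $(q)_k=q(q+1)\cdots(q+k-1)$. The product in the formula for $f(\vec v;z)$ is a polynomial in $z$ with rational coefficients whose denominators are prime to $p$, so it can be reduced modulo $p$ and evaluated at $z\in\mathbb{F}_p$. The count $\#E_z(\mathbb{F}_p)$ refers to the projective curve, i.e. it includes the point at infinity. *)

theory Defs
  imports "Jordan_Normal_Form.Char_Poly" "HOL-Number_Theory.Cong"
begin

definition sym_pascal :: "nat \<Rightarrow> rat mat" where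
  "sym_pascal N = mat (N + 1) (N + 1) (\<lambda>(j, k). of_nat ((j + k) choose j))"

definition gen_fun :: "nat \<Rightarrow> rat vec \<Rightarrow> rat \<Rightarrow> rat" where
  "gen_fun N v z = (\<Sum>k\<le>N. v $ k * z ^ (N - k))"

(* The terminating series 2F1(-m, b; c; x). The upper limit m is essential: in the
   application c = -2m, so (c)_k vanishes for large k, where division by 0 would
   yield 0. *)
definition hyp2F1_terminating :: "nat \<Rightarrow> rat \<Rightarrow> rat \<Rightarrow> rat \<Rightarrow> rat" where
  "hyp2F1_terminating m b c x =
     (\<Sum>k\<le>m. pochhammer (- of_nat m) k * pochhammer b k / (pochhammer c k * fact k) * x ^ k)"

definition pascal_hyp :: "nat \<Rightarrow> rat \<Rightarrow> rat" where
  "pascal_hyp N x = hyp2F1_terminating (N div 2) (of_nat N / 2 + 1) (- of_nat N) x"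

(* quotient_of returns a fraction in lowest terms. *)
definition p_integral :: "nat \<Rightarrow> rat \<Rightarrow> bool" where
  "p_integral p q \<longleftrightarrow> coprime (snd (quotient_of q)) (int p)"

(* Congruence modulo p in the ring of rationals with denominator prime to p,
   that is, a - b lies in its ideal generated by p. *)
definition rat_cong :: "nat \<Rightarrow> rat \<Rightarrow> rat \<Rightarrow> bool" where
  "rat_cong p a b \<longleftrightarrow> (\<exists>c. p_integral p c \<and> a - b = of_nat p * c)"

(* The points over F_p of the projective curve y^2 = x (x - 1) (x - z), with F_p
   represented by the residues 0, ..., p - 1 and None the point at infinity. *)
definition legendre_points :: "nat \<Rightarrow> int \<Rightarrow> (int \<times> int) option set" where
  "legendre_points p z =
     insert None (Some ` {(x, y). x \<in> {0..<int p} \<and> y \<in> {0..<int p} \<and>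
       [y ^ 2 = x * (x - 1) * (x - z)] (mod int p)})"

end

theory Submission
  imports Defs "HOL-Number_Theory.Residues"
begin

text \<open>
  Write \<open>p = 2m + 1\<close>, so \<open>N = 2m\<close>, and let
  \<open>h(z) = \<Sum>k\<le>m. (m choose k)\<^sup>2 z\<^sup>k\<close> be the Hasse polynomial of the Legendre family. The theorem
  holds because, modulo \<open>p\<close>, both hypergeometric factors of the generating function reduce to \<open>h\<close>,
  while \<open>#E\<^sub>z - 1\<close> reduces to \<open>\<plusminus>h(z)\<close>; squaring removes the sign.

  For the first factor, the exact coefficient of \<open>x\<^sup>k\<close> is
  \<open>(m choose k) (m+k choose k) / (2m choose k)\<close> (lemma \<open>pascal_hyp_even\<close>). Since \<open>2m \<equiv> -1\<close> and
  \<open>m + i \<equiv> -(m + 1 - i)\<close> modulo \<open>p\<close>, the binomials \<open>2m choose k\<close> and \<open>m+k choose k\<close> are congruent to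
  \<open>(-1)\<^sup>k\<close> and \<open>(-1)\<^sup>k (m choose k)\<close>, and the signs cancel (lemma \<open>pascal_coeff_cong\<close>).

  For the second factor, absorbing \<open>(1-z)\<^sup>m\<close> turns the series in \<open>z/(z-1)\<close> into a polynomial in \<open>z\<close>.
  Its reduction \<open>\<Sum>k. (m choose k)\<^sup>2 (-z)\<^sup>k (1-z)\<^sup>m\<^sup>-\<^sup>k\<close> equals, by Vandermonde's identity,
  \<open>\<Sum>j. (m choose j) (m+j choose j) (-z)\<^sup>j\<close>: two classical expressions for the Legendre polynomial
  \<open>P\<^sub>m(1-2z)\<close>. The congruence for \<open>m+j choose j\<close> then gives \<open>h\<close> again (lemma
  \<open>pascal_hyp_pfaff_cong\<close>).

  On the side of the curve, every affine fibre over \<open>x\<close> has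
  \<open>1 + (x(x-1)(x-z))\<^sup>m\<close> points modulo \<open>p\<close>, and summing over \<open>x\<close> extracts the coefficient of
  \<open>x\<^sup>p\<^sup>-\<^sup>1\<close>, because \<open>\<Sum>x. x\<^sup>j\<close> over \<open>\<F>\<^sub>p\<close> is \<open>-1\<close> when \<open>p - 1\<close> divides \<open>j > 0\<close> and \<open>0\<close>
  otherwise. That coefficient is \<open>(-1)\<^sup>m h(z)\<close> (lemma \<open>card_legendre_points_cong\<close>).

  Finally, the entries of \<open>v\<close> are integral at \<open>p\<close>: the generating function and the product of the two
  factors agree at infinitely many points, hence as polynomials, and the product has
  integral coefficients.
\<close>

section \<open>Rationals integral at a prime\<close>

text \<open>The definition refers to the reduced fraction; ring operations produce unreduced ones. An
  arbitrary representing fraction with denominator prime to \<open>p\<close> suffices because the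
  reduced denominator divides every other one.\<close>
lemma p_integral_iff:
  "p_integral p q \<longleftrightarrow> (\<exists>a b. b \<noteq> 0 \<and> coprime b (int p) \<and> q = of_int a / of_int b)"
proof
  obtain n d where nd: "quotient_of q = (n, d)" by fastforce
  have d: "d > 0" and q: "q = of_int n / of_int d" and cop: "coprime n d"
    using nd by (auto intro: quotient_of_denom_pos quotient_of_div quotient_of_coprime)
  show "\<exists>a b. b \<noteq> 0 \<and> coprime b (int p) \<and> q = of_int a / of_int b" if "p_integral p q"
    using that nd d q by (intro exI[of _ n] exI[of _ d]) (auto simp: p_integral_def)
  assume "\<exists>a b. b \<noteq> 0 \<and> coprime b (int p) \<and> q = of_int a / of_int b"
  then obtain a b where b: "b \<noteq> 0" "coprime b (int p)" and ab: "q = of_int a / of_int b" by blast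
  have "(of_int (n * b) :: rat) = of_int (a * d)"
    using q ab b d by (simp add: field_simps)
  then have "n * b = a * d" by linarith
  then have "d dvd b"
    using cop by (metis coprime_commute coprime_dvd_mult_right_iff dvd_triv_right)
  then show "p_integral p q"
    using coprime_divisors[OF _ dvd_refl b(2)] nd by (simp add: p_integral_def)
qed

lemma p_integral_of_int [simp]: "p_integral p (of_int a)"
  unfolding p_integral_iff by (rule exI[of _ a], rule exI[of _ 1]) simp

lemma p_integral_of_nat [simp]: "p_integral p (of_nat a)"
  using p_integral_of_int[of p "int a"] by simp

lemma p_integral_0 [simp]: "p_integral p 0" and p_integral_1 [simp]: "p_integral p 1"
  using p_integral_of_int[of p 0] p_integral_of_int[of p 1] by auto

lemma p_integral_add [intro]:
  assumes "p_integral p x" "p_integral p y" shows "p_integral p (x + y)"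
proof -
  obtain a b c d where "b \<noteq> 0" "coprime b (int p)" "x = of_int a / of_int b"
    "d \<noteq> 0" "coprime d (int p)" "y = of_int c / of_int d"
    using assms unfolding p_integral_iff by blast
  then show ?thesis unfolding p_integral_iff
    by (intro exI[of _ "a * d + c * b"] exI[of _ "b * d"]) (auto simp: field_simps)
qed

lemma p_integral_mult [intro]:
  assumes "p_integral p x" "p_integral p y" shows "p_integral p (x * y)"
proof -
  obtain a b c d where "b \<noteq> 0" "coprime b (int p)" "x = of_int a / of_int b"
    "d \<noteq> 0" "coprime d (int p)" "y = of_int c / of_int d"
    using assms unfolding p_integral_iff by blast
  then show ?thesis unfolding p_integral_iff
    by (intro exI[of _ "a * c"] exI[of _ "b * d"]) auto
qed

lemma p_integral_uminus [intro]: "p_integral p x \<Longrightarrow> p_integral p (- x)"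
  using p_integral_mult[OF p_integral_of_int[of p "-1"]] by simp

lemma p_integral_sum [intro]: "(\<And>i. i \<in> A \<Longrightarrow> p_integral p (f i)) \<Longrightarrow> p_integral p (sum f A)"
  by (induction A rule: infinite_finite_induct) auto

lemma p_integral_power [intro]: "p_integral p x \<Longrightarrow> p_integral p (x ^ n)"
  by (induction n) auto

lemma p_integral_divide_nat:
  assumes "p_integral p x" "coprime b p" "b \<noteq> 0"
  shows "p_integral p (x / of_nat b)"
proof -
  have "p_integral p (1 / of_nat b)"
    unfolding p_integral_iff using assms by (intro exI[of _ 1] exI[of _ "int b"]) auto
  from p_integral_mult[OF assms(1) this] show ?thesis by simp
qed

lemma rat_cong_of_int:
  assumes "[a = b] (mod int p)" shows "rat_cong p (of_int a) (of_int b)"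
proof -
  obtain c where "a - b = int p * c"
    using assms by (auto simp: cong_iff_dvd_diff)
  then have "(of_int a :: rat) - of_int b = of_nat p * of_int c"
    by (metis of_int_diff of_int_mult of_int_of_nat_eq)
  then show ?thesis unfolding rat_cong_def using p_integral_of_int by blast
qed

lemma rat_cong_trans [trans]:
  assumes "rat_cong p a b" "rat_cong p b c" shows "rat_cong p a c"
proof -
  obtain x y where "p_integral p x" "a - b = of_nat p * x" "p_integral p y" "b - c = of_nat p * y"
    using assms unfolding rat_cong_def by blast
  then show ?thesis unfolding rat_cong_def
    by (intro exI[of _ "x + y"]) (auto simp: algebra_simps)
qed

lemma rat_cong_add:
  assumes "rat_cong p a b" "rat_cong p c d" shows "rat_cong p (a + c) (b + d)"
proof -
  obtain x y where "p_integral p x" "a - b = of_nat p * x" "p_integral p y" "c - d = of_nat p * y"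
    using assms unfolding rat_cong_def by blast
  then show ?thesis unfolding rat_cong_def
    by (intro exI[of _ "x + y"]) (auto simp: algebra_simps)
qed

lemma rat_cong_scale:
  assumes "rat_cong p a b" "p_integral p c" shows "rat_cong p (a * c) (b * c)"
proof -
  obtain x where "p_integral p x" "a - b = of_nat p * x"
    using assms unfolding rat_cong_def by blast
  then show ?thesis unfolding rat_cong_def using assms(2)
    by (intro exI[of _ "x * c"]) (auto simp flip: left_diff_distrib)
qed

lemma rat_cong_sum:
  "(\<And>i. i \<in> A \<Longrightarrow> rat_cong p (f i) (g i)) \<Longrightarrow> rat_cong p (sum f A) (sum g A)"
proof (induction A rule: infinite_finite_induct)
  case (insert x F)
  then show ?case by (simp add: rat_cong_add)
qed (use rat_cong_of_int[of 0 0 p] in auto)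

lemma rat_cong_mult:
  assumes "rat_cong p a b" "rat_cong p c d" "p_integral p b" "p_integral p c"
  shows "rat_cong p (a * c) (b * d)"
proof -
  have "rat_cong p (a * c) (b * c)" using assms rat_cong_scale by blast
  also have "rat_cong p (b * c) (b * d)" using assms rat_cong_scale[of p c d b] by (simp add: mult.commute)
  finally show ?thesis .
qed

section \<open>Binomial coefficients modulo a prime\<close>

text \<open>By Pascal's rule, neighbours in row \<open>p - 1\<close> add up to an inner entry of row \<open>p\<close>, which \<open>p\<close>
  divides; so the entries alternate in sign, starting from \<open>1\<close>.\<close>
lemma choose_pred_prime_cong:
  fixes p :: nat
  assumes "prime p" "k < p"
  shows "[int ((p - 1) choose k) = (-1) ^ k] (mod int p)"
  using assms(2)
proof (induction k)
  case (Suc k)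
  have "p dvd (p choose Suc k)"
    using assms(1) Suc.prems by (intro dvd_choose_prime) auto
  moreover have "p choose Suc k = ((p - 1) choose k) + ((p - 1) choose Suc k)"
    using assms(1) by (metis Suc_diff_1 binomial_Suc_Suc prime_gt_0_nat)
  ultimately have "[int ((p - 1) choose k) + int ((p - 1) choose Suc k) = 0] (mod int p)"
    by (metis cong_0_iff of_nat_add of_nat_dvd_iff)
  from cong_diff[OF this Suc.IH] show ?case using Suc.prems by simp
qed simp

text \<open>This is \<open>m + i \<equiv> -(m + 1 - i)\<close> for the \<open>i\<close>-th factors of the two numerators, carried out by
  induction since the factor \<open>k + 1\<close> of the denominator can be cancelled modulo \<open>p\<close>.\<close>
lemma choose_half_cong:
  fixes p m :: nat
  assumes "prime p" "p = 2 * m + 1" "k \<le> m"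
  shows "[int ((m + k) choose k) = (-1) ^ k * int (m choose k)] (mod int p)"
  using assms(3)
proof (induction k)
  case (Suc k)
  have up: "int (Suc k) * int ((m + Suc k) choose Suc k) = int (m + Suc k) * int ((m + k) choose k)"
    using Suc_times_binomial[of k "m + k"] by (metis add_Suc_right of_nat_mult)
  have down: "int (Suc k) * int (m choose Suc k) = int (m - k) * int (m choose k)"
    using binomial_absorb_comp[of m k] binomial_absorption[of k m]
    by (metis of_nat_mult mult.commute)
  have neg: "[int (m + Suc k) = - int (m - k)] (mod int p)"
    using Suc.prems assms(2) by (simp add: cong_iff_dvd_diff of_nat_diff)
  have "[int (m + Suc k) * int ((m + k) choose k) =
      - int (m - k) * ((-1) ^ k * int (m choose k))] (mod int p)"
    using Suc by (intro cong_mult neg) auto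
  then have "[int (Suc k) * int ((m + Suc k) choose Suc k) =
      int (Suc k) * ((-1) ^ Suc k * int (m choose Suc k))] (mod int p)"
    unfolding up using down by (metis (no_types, lifting) mult.left_commute mult_minus_left mult_minus1 power_Suc)
  moreover have "coprime (int (Suc k)) (int p)"
    using assms Suc.prems
    by (metis Suc_eq_plus1 coprime_commute coprime_int_iff dvd_imp_le le_add1 le_trans
        less_Suc_eq_le mult_2 not_less prime_imp_coprime zero_less_Suc)
  ultimately show ?case using cong_mult_lcancel by blast
qed simp

text \<open>With \<open>w = -z\<close> both sides are the Legendre polynomial \<open>P\<^sub>m(1 - 2z)\<close>. Comparing coefficients of
  \<open>w\<^sup>j\<close>, the identity \<open>(m choose k) (m-k choose j-k) = (m choose j) (j choose k)\<close> pulls out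
  \<open>m choose j\<close>, and what remains is Vandermonde's convolution for \<open>m+j choose j\<close>.\<close>

lemma sum_binomial_squares_shift:
  fixes w :: "'a :: comm_ring_1"
  shows "(\<Sum>k\<le>m. of_nat (m choose k) ^ 2 * w ^ k * (1 + w) ^ (m - k)) =
    (\<Sum>j\<le>m. of_nat ((m choose j) * ((m + j) choose j)) * w ^ j)"
proof -
  have "(\<Sum>k\<le>m. of_nat (m choose k) ^ 2 * w ^ k * (1 + w) ^ (m - k)) =
    (\<Sum>k\<le>m. \<Sum>j\<in>{k..m}. of_nat ((m choose j) * ((m choose k) * (j choose (j - k)))) * w ^ j)"
  proof (rule sum.cong[OF refl])
    fix k assume k: "k \<in> {..m}"
    have "(1 + w) ^ (m - k) = (\<Sum>i\<le>m - k. of_nat ((m - k) choose i) * w ^ i)"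
      using binomial_ring[of w 1 "m - k"] by (simp add: add.commute)
    also have "\<dots> = (\<Sum>j\<in>{k..m}. of_nat ((m - k) choose (j - k)) * w ^ (j - k))"
      by (rule sum.reindex_bij_witness[of _ "\<lambda>j. j - k" "\<lambda>i. i + k"]) (use k in auto)
    finally have "of_nat (m choose k) ^ 2 * w ^ k * (1 + w) ^ (m - k) =
      (\<Sum>j\<in>{k..m}. of_nat (m choose k) ^ 2 * w ^ k * (of_nat ((m - k) choose (j - k)) * w ^ (j - k)))"
      by (simp add: sum_distrib_left)
    also have "\<dots> = (\<Sum>j\<in>{k..m}. of_nat ((m choose j) * ((m choose k) * (j choose (j - k)))) * w ^ j)"
    proof (rule sum.cong[OF refl])
      fix j assume j: "j \<in> {k..m}"
      have "(m choose j) * (j choose (j - k)) = (m choose k) * ((m - k) choose (j - k))"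
        using choose_mult[of k j m] j binomial_symmetric[of k j] by simp
      then have e: "(of_nat (m choose j) * of_nat (j choose (j - k)) :: 'a) =
          of_nat (m choose k) * of_nat ((m - k) choose (j - k))"
        by (metis of_nat_mult)
      have "w ^ j = w ^ k * w ^ (j - k)" using j by (simp flip: power_add)
      then have "of_nat (m choose k) ^ 2 * w ^ k * (of_nat ((m - k) choose (j - k)) * w ^ (j - k)) =
        of_nat (m choose k) * (of_nat (m choose k) * of_nat ((m - k) choose (j - k))) * w ^ j"
        by (simp add: power2_eq_square mult_ac)
      then show "of_nat (m choose k) ^ 2 * w ^ k * (of_nat ((m - k) choose (j - k)) * w ^ (j - k)) =
        of_nat ((m choose j) * ((m choose k) * (j choose (j - k)))) * w ^ j"
        by (simp add: mult_ac flip: e)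
    qed
    finally show "of_nat (m choose k) ^ 2 * w ^ k * (1 + w) ^ (m - k) =
      (\<Sum>j\<in>{k..m}. of_nat ((m choose j) * ((m choose k) * (j choose (j - k)))) * w ^ j)" .
  qed
  also have "\<dots> = (\<Sum>j\<le>m. \<Sum>k\<le>j. of_nat ((m choose j) * ((m choose k) * (j choose (j - k)))) * w ^ j)"
    unfolding sum.Sigma[OF finite_atMost ballI[OF finite_atLeastAtMost]]
      sum.Sigma[OF finite_atMost ballI[OF finite_atMost]]
    by (rule sum.reindex_bij_witness[of _ prod.swap prod.swap]) auto
  also have "\<dots> = (\<Sum>j\<le>m. of_nat ((m choose j) * ((m + j) choose j)) * w ^ j)"
    by (simp only: vandermonde[of m, symmetric] of_nat_mult of_nat_sum sum_distrib_left sum_distrib_right)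
  finally show ?thesis .
qed

section \<open>Power sums\<close>

text \<open>Telescoping \<open>(x + 1)\<^sup>j\<^sup>+\<^sup>1 - x\<^sup>j\<^sup>+\<^sup>1\<close> over \<open>x < p\<close> gives \<open>p\<^sup>j\<^sup>+\<^sup>1 \<equiv> 0\<close>. Expanding the same
  difference binomially expresses it through the power sums of exponent at most \<open>j\<close>; those below
  \<open>j\<close> vanish inductively, and the remaining factor \<open>j + 1 < p\<close> is invertible.\<close>
lemma prime_power_sum_cong_0:
  fixes p :: nat
  assumes "prime p" "j < p - 1"
  shows "[(\<Sum>x<p. int x ^ j) = 0] (mod int p)"
  using assms(2)
proof (induction j rule: less_induct)
  case (less j)
  have "int p ^ Suc j = (\<Sum>x<p. int (Suc x) ^ Suc j - int x ^ Suc j)"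
    by (subst sum_lessThan_telescope) simp
  also have "\<dots> = (\<Sum>x<p. \<Sum>i\<le>j. int (Suc j choose i) * int x ^ i)"
  proof (rule sum.cong[OF refl])
    fix x
    show "int (Suc x) ^ Suc j - int x ^ Suc j = (\<Sum>i\<le>j. int (Suc j choose i) * int x ^ i)"
      using binomial_ring[of "int x" 1 "Suc j"] by (simp add: add.commute)
  qed
  also have "\<dots> = (\<Sum>i\<le>j. int (Suc j choose i) * (\<Sum>x<p. int x ^ i))"
    by (subst sum.swap) (simp add: sum_distrib_left)
  also have "\<dots> = (\<Sum>i<j. int (Suc j choose i) * (\<Sum>x<p. int x ^ i)) + int (Suc j) * (\<Sum>x<p. int x ^ j)"
    by (simp add: lessThan_Suc_atMost[symmetric])
  finally have eq: "int p ^ Suc j = \<dots>" .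
  have "[(\<Sum>i<j. int (Suc j choose i) * (\<Sum>x<p. int x ^ i)) = (\<Sum>i<j. int (Suc j choose i) * 0)] (mod int p)"
    using less by (intro cong_sum cong_mult) auto
  moreover have "int p dvd int p ^ Suc j" by simp
  ultimately have "int p dvd int (Suc j) * (\<Sum>x<p. int x ^ j)"
    unfolding eq cong_0_iff sum.neutral_const mult_zero_right by (simp add: dvd_add_right_iff cong_0_iff)
  moreover have "\<not> int p dvd int (Suc j)"
    using less.prems unfolding of_nat_dvd_iff by (metis dvd_imp_le less_diff_conv not_less Suc_eq_plus1 zero_less_Suc)
  ultimately have "int p dvd (\<Sum>x<p. int x ^ j)"
    using assms(1) by (metis prime_dvd_mult_iff prime_nat_int_transfer)
  then show ?case by (simp add: cong_0_iff)
qed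

lemma fermat_int_cong:
  fixes p :: nat
  assumes "prime p"
  shows "[a ^ (p - 1) = (if int p dvd a then 0 else 1)] (mod int p)"
proof (cases "int p dvd a")
  case True
  then show ?thesis using prime_gt_1_nat[OF assms]
    by (simp add: cong_0_iff dvd_power_le[of _ _ 1 "p - 1", simplified])
next
  case False
  define b where "b = nat (a mod int p)"
  have b: "int b = a mod int p"
    using prime_gt_0_nat[OF assms] by (simp add: b_def)
  have "\<not> p dvd b"
    using False b by (metis dvd_mod_iff dvd_refl of_nat_dvd_iff)
  then have "[int b ^ (p - 1) = 1] (mod int p)"
    using fermat_theorem[OF assms] cong_int_iff[of "b ^ (p - 1)" 1 p] by simp
  then show ?thesis using False
    by (simp add: b cong_def power_mod)
qed

text \<open>The orthogonality relation that makes summation over \<open>\<F>\<^sub>p\<close> read off coefficients. Fermat's theorem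
  reduces every positive exponent modulo \<open>p - 1\<close>. The exponent \<open>0\<close> is exceptional because
  \<open>0\<^sup>0 = 1\<close> makes its sum \<open>p\<close> instead of \<open>p - 1\<close>.\<close>
lemma power_sum_cong:
  fixes p :: nat
  assumes "prime p"
  shows "[(\<Sum>x\<in>{0..<int p}. x ^ j) = (if j > 0 \<and> (p - 1) dvd j then -1 else 0)] (mod int p)"
proof (induction j rule: less_induct)
  case (less j)
  have p: "p > 1" using assms by (rule prime_gt_1_nat)
  have zero: "{x \<in> {0..<int p}. int p dvd x} = {0}"
    using p by (auto dest: zdvd_imp_le)
  consider "j < p - 1" | "j = p - 1" | "j > p - 1" by linarith
  then show ?case
  proof cases
    case 1
    have "(\<Sum>x\<in>{0..<int p}. x ^ j) = (\<Sum>x<p. int x ^ j)"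
      by (rule sum.reindex_bij_witness[of _ int nat]) auto
    then show ?thesis
      using prime_power_sum_cong_0[OF assms 1] 1 by (auto dest: dvd_imp_le)
  next
    case 2
    have "[(\<Sum>x\<in>{0..<int p}. x ^ j) = (\<Sum>x\<in>{0..<int p}. if int p dvd x then 0 else 1)] (mod int p)"
      unfolding 2 by (intro cong_sum fermat_int_cong assms)
    also have "(\<Sum>x\<in>{0..<int p}. if int p dvd x then 0 else 1) = (\<Sum>x\<in>{0..<int p} - {0}. 1 :: int)"
      using zero by (intro sum.mono_neutral_cong_right) auto
    also have "\<dots> = int p - 1" using p by simp
    also have "[int p - 1 = - 1] (mod int p)" by (simp add: cong_iff_dvd_diff)
    finally show ?thesis using 2 p by simp
  next
    case 3
    define i where "i = j - (p - 1)"
    have i: "j = i + (p - 1)" "i > 0" "i < j" using 3 p by (auto simp: i_def)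
    have "[x ^ j = x ^ i] (mod int p)" for x
    proof (cases "int p dvd x")
      case True
      then have "int p dvd x ^ n" if "n > 0" for n using that by (simp add: dvd_power_le dvd_trans[OF _ dvd_power])
      then show ?thesis using i by (simp add: cong_iff_dvd_diff)
    next
      case False
      then show ?thesis
        using cong_mult[OF cong_refl[of "x ^ i"] fermat_int_cong[OF assms, of x]] i(1)
        by (simp only: power_add if_False mult_1_right)
    qed
    then have "[(\<Sum>x\<in>{0..<int p}. x ^ j) = (\<Sum>x\<in>{0..<int p}. x ^ i)] (mod int p)"
      by (intro cong_sum)
    note cong_trans[OF this less.IH[OF \<open>i < j\<close>]]
    moreover have "(p - 1) dvd j \<longleftrightarrow> (p - 1) dvd i"
      unfolding i(1) by (rule dvd_add_triv_right_iff)
    ultimately show ?thesis using i(2) 3 by simp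
  qed
qed

section \<open>Counting points\<close>

text \<open>By Fermat, \<open>1 - (y\<^sup>2 - a)\<^sup>p\<^sup>-\<^sup>1\<close> is the indicator of \<open>y\<^sup>2 \<equiv> a\<close> modulo \<open>p\<close>. Summed over \<open>y\<close>, only
  the exponents \<open>p - 1\<close> and \<open>2(p - 1)\<close> of \<open>y\<close> survive, and they contribute \<open>a\<^sup>m\<close> and \<open>1\<close>. This
  covers \<open>a \<equiv> 0\<close>, residues and non-residues uniformly.\<close>
lemma card_square_roots_cong:
  fixes p m :: nat and a :: int
  assumes "prime p" "p = 2 * m + 1"
  shows "[int (card {y \<in> {0..<int p}. [y ^ 2 = a] (mod int p)}) = 1 + a ^ m] (mod int p)"
proof -
  have m: "m > 0" "p - 1 = 2 * m" using assms prime_gt_1_nat[OF assms(1)] by auto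
  have "int (card {y \<in> {0..<int p}. [y ^ 2 = a] (mod int p)}) =
      (\<Sum>y\<in>{0..<int p}. 1 - (if int p dvd y ^ 2 - a then 0 else 1))"
    by (simp add: cong_iff_dvd_diff sum.If_cases Int_def if_distrib cong: if_cong)
  also have "[\<dots> = (\<Sum>y\<in>{0..<int p}. 1 - (y ^ 2 - a) ^ (p - 1))] (mod int p)"
    by (intro cong_sum cong_diff cong_refl cong_sym[OF fermat_int_cong] assms)
  also have "(\<Sum>y\<in>{0..<int p}. 1 - (y ^ 2 - a) ^ (p - 1)) =
      int p - (\<Sum>y\<in>{0..<int p}. \<Sum>j\<le>2 * m. int (2 * m choose j) * (- a) ^ (2 * m - j) * y ^ (2 * j))"
  proof -
    have "(y ^ 2 - a) ^ (p - 1) =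
        (\<Sum>j\<le>2 * m. int (2 * m choose j) * (- a) ^ (2 * m - j) * y ^ (2 * j))" for y
      unfolding m power_mult[of y]
      using binomial_ring[of "y ^ 2" "- a" "2 * m"] by (simp only: diff_conv_add_uminus of_nat_id mult_ac)
    then show ?thesis by (simp add: sum_subtractf)
  qed
  also have "\<dots> = int p - (\<Sum>j\<le>2 * m. int (2 * m choose j) * (- a) ^ (2 * m - j) *
      (\<Sum>y\<in>{0..<int p}. y ^ (2 * j)))"
    by (subst sum.swap) (simp add: sum_distrib_left)
  also have "[\<dots> = int p - (\<Sum>j\<le>2 * m. int (2 * m choose j) * (- a) ^ (2 * m - j) *
      (if 2 * j > 0 \<and> (p - 1) dvd 2 * j then -1 else 0))] (mod int p)"
    by (intro cong_sum cong_diff cong_mult cong_refl power_sum_cong assms)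
  \<comment> \<open>For \<open>0 < j \<le> 2m\<close>, \<open>2m\<close> divides \<open>2j\<close> exactly when \<open>j\<close> is \<open>m\<close> or \<open>2m\<close>.\<close>
  also have "(\<Sum>j\<le>2 * m. int (2 * m choose j) * (- a) ^ (2 * m - j) *
      (if 2 * j > 0 \<and> (p - 1) dvd 2 * j then -1 else 0)) =
      (\<Sum>j\<in>{m, 2 * m}. - (int (2 * m choose j) * (- a) ^ (2 * m - j)))"
  proof (rule sum.mono_neutral_cong_right)
    have "j = m \<or> j = 2 * m" if j: "j \<le> 2 * m" "0 < j" "m dvd j" for j
    proof -
      obtain k where k: "j = m * k" using j(3) by blast
      then have "k \<le> 2" "k > 0" using j m by (auto simp: mult.commute[of m])
      then have "k = 1 \<or> k = 2" by linarith
      then show ?thesis using k by auto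
    qed
    then show "\<forall>j\<in>{..2 * m} - {m, 2 * m}. int (2 * m choose j) * (- a) ^ (2 * m - j) *
        (if 2 * j > 0 \<and> (p - 1) dvd 2 * j then -1 else 0) = 0"
      using m by auto
  qed (use m in auto)
  also have "int p - \<dots> = int p + 1 + int (2 * m choose m) * (- a) ^ m"
    using m by simp
  also have "[\<dots> = 0 + 1 + (-1) ^ m * (- a) ^ m] (mod int p)"
    using choose_pred_prime_cong[OF assms(1), of m] assms(2)
    by (intro cong_add cong_mult) (auto simp: cong_0_iff)
  also have "(-1) ^ m * (- a) ^ m = a ^ m" by (simp flip: power_mult_distrib)
  finally show ?thesis by simp
qed

text \<open>The monomials of \<open>x\<^sup>m (x-1)\<^sup>m (x-z)\<^sup>m\<close> have exponents between \<open>m\<close> and \<open>3m < 2(p-1)\<close>, so only the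
  coefficient of \<open>x\<^sup>p\<^sup>-\<^sup>1 = x\<^sup>2\<^sup>m\<close> survives the summation over \<open>x\<close>.\<close>
lemma legendre_cubic_power_sum_cong:
  fixes p m :: nat and z :: int
  assumes "prime p" "p = 2 * m + 1"
  shows "[(\<Sum>x\<in>{0..<int p}. (x * (x - 1) * (x - z)) ^ m) =
    - ((-1) ^ m * (\<Sum>k\<le>m. int (m choose k) ^ 2 * z ^ k))] (mod int p)"
proof -
  have m: "m > 0" "p - 1 = 2 * m" using assms prime_gt_1_nat[OF assms(1)] by auto
  define A where "A i = int (m choose i) * (-1) ^ (m - i)" for i
  define B where "B j = int (m choose j) * (- z) ^ (m - j)" for j
  have "(x * (x - 1) * (x - z)) ^ m = (\<Sum>i\<le>m. \<Sum>j\<le>m. A i * B j * x ^ (m + i + j))" for x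
  proof -
    have "(x - 1) ^ m = (\<Sum>i\<le>m. A i * x ^ i)"
      using binomial_ring[of x "-1" m] by (simp add: A_def mult_ac)
    moreover have "(x - z) ^ m = (\<Sum>j\<le>m. B j * x ^ j)"
      using binomial_ring[of x "-z" m] by (simp add: B_def mult_ac)
    ultimately have "(x * (x - 1) * (x - z)) ^ m =
        x ^ m * ((\<Sum>i\<le>m. A i * x ^ i) * (\<Sum>j\<le>m. B j * x ^ j))"
      by (simp add: power_mult_distrib mult.assoc)
    also have "\<dots> = (\<Sum>i\<le>m. \<Sum>j\<le>m. A i * B j * x ^ (m + i + j))"
      unfolding sum_product by (simp add: sum_distrib_left power_add mult_ac)
    finally show ?thesis .
  qed
  then have "(\<Sum>x\<in>{0..<int p}. (x * (x - 1) * (x - z)) ^ m) =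
      (\<Sum>i\<le>m. \<Sum>j\<le>m. A i * B j * (\<Sum>x\<in>{0..<int p}. x ^ (m + i + j)))"
    by (simp add: sum_distrib_left sum.swap[of _ _ "{0..<int p}"])
  also have "[\<dots> = (\<Sum>i\<le>m. \<Sum>j\<le>m. A i * B j *
      (if m + i + j > 0 \<and> (p - 1) dvd m + i + j then -1 else 0))] (mod int p)"
    by (intro cong_sum cong_mult cong_refl power_sum_cong assms)
  also have "(\<Sum>i\<le>m. \<Sum>j\<le>m. A i * B j *
      (if m + i + j > 0 \<and> (p - 1) dvd m + i + j then -1 else 0)) = (\<Sum>i\<le>m. - (A i * B (m - i)))"
  proof (rule sum.cong[OF refl])
    fix i assume i: "i \<in> {..m}"
    have "(m + i + j > 0 \<and> (p - 1) dvd m + i + j) \<longleftrightarrow> j = m - i" if "j \<le> m" for j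
    proof
      assume "m + i + j > 0 \<and> (p - 1) dvd m + i + j"
      then obtain k where k: "m + i + j = 2 * m * k" using m by auto
      have "k < 2"
      proof (rule ccontr)
        assume "\<not> k < 2"
        then have "2 * m * 2 \<le> 2 * m * k" by (intro mult_left_mono) auto
        then show False using k i that m by (simp only: atMost_iff)
      qed
      moreover have "k \<noteq> 0" using k m by (intro notI) simp
      ultimately have "k = 1" by simp
      then show "j = m - i" using k by simp
    qed (use i m in \<open>auto simp flip: mult_2\<close>)
    then have "(\<Sum>j\<le>m. A i * B j * (if m + i + j > 0 \<and> (p - 1) dvd m + i + j then -1 else 0)) =
        (\<Sum>j\<le>m. if j = m - i then - (A i * B j) else 0)"
      by (intro sum.cong) auto
    then show "(\<Sum>j\<le>m. A i * B j * (if m + i + j > 0 \<and> (p - 1) dvd m + i + j then -1 else 0)) =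
        - (A i * B (m - i))"
      by simp
  qed
  also have "\<dots> = - ((-1) ^ m * (\<Sum>k\<le>m. int (m choose k) ^ 2 * z ^ k))"
  proof -
    have "A i * B (m - i) = (-1) ^ m * (int (m choose i) ^ 2 * z ^ i)" if "i \<le> m" for i
    proof -
      have "(-1 :: int) ^ (m - i) * (- z) ^ i = (-1) ^ (m - i) * (-1) ^ i * z ^ i"
        by (simp add: power_minus[of z])
      also have "(-1 :: int) ^ (m - i) * (-1) ^ i = (-1) ^ m"
        using that by (simp flip: power_add)
      finally show ?thesis
        using that binomial_symmetric[of i m] by (simp add: A_def B_def power2_eq_square mult_ac)
    qed
    then show ?thesis by (simp add: sum_negf sum_distrib_left)
  qed
  finally show ?thesis .
qed

text \<open>The point at infinity accounts for the subtracted \<open>1\<close>; the affine points are counted fibrewise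
  over \<open>x\<close>.\<close>
lemma card_legendre_points_cong:
  assumes "prime p" "p = 2 * m + 1"
  shows "[int (card (legendre_points p z)) - 1 =
    - ((-1) ^ m * (\<Sum>k\<le>m. int (m choose k) ^ 2 * z ^ k))] (mod int p)"
proof -
  define R where "R x = {y \<in> {0..<int p}. [y ^ 2 = x * (x - 1) * (x - z)] (mod int p)}" for x
  have aff: "{(x, y). x \<in> {0..<int p} \<and> y \<in> {0..<int p} \<and>
      [y ^ 2 = x * (x - 1) * (x - z)] (mod int p)} = Sigma {0..<int p} R"
    by (auto simp: R_def)
  have "finite (R x)" for x unfolding R_def by (rule finite_subset[of _ "{0..<int p}"]) auto
  then have "card (legendre_points p z) = 1 + (\<Sum>x\<in>{0..<int p}. card (R x))"
    unfolding legendre_points_def aff by (subst card_insert_disjoint) (auto simp: card_image)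
  then have "int (card (legendre_points p z)) - 1 = (\<Sum>x\<in>{0..<int p}. int (card (R x)))" by simp
  also have "[\<dots> = (\<Sum>x\<in>{0..<int p}. 1 + (x * (x - 1) * (x - z)) ^ m)] (mod int p)"
    unfolding R_def by (intro cong_sum card_square_roots_cong assms)
  also have "(\<Sum>x\<in>{0..<int p}. 1 + (x * (x - 1) * (x - z)) ^ m) =
      int p + (\<Sum>x\<in>{0..<int p}. (x * (x - 1) * (x - z)) ^ m)"
    by (simp add: sum.distrib)
  also have "[\<dots> = 0 + - ((-1) ^ m * (\<Sum>k\<le>m. int (m choose k) ^ 2 * z ^ k))] (mod int p)"
    by (intro cong_add legendre_cubic_power_sum_cong assms) (simp add: cong_0_iff)
  finally show ?thesis by simp
qed

section \<open>The hypergeometric polynomial modulo p\<close>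

definition pascal_coeff :: "nat \<Rightarrow> nat \<Rightarrow> rat" where
  "pascal_coeff m k =
     of_nat ((m choose k) * ((m + k) choose k)) / of_nat ((2 * m) choose k)"

text \<open>All three Pochhammer symbols are, up to sign, \<open>k!\<close> times a binomial coefficient. The bound \<open>k \<le> m\<close>
  keeps the denominator \<open>2m choose k\<close> away from \<open>0\<close>.\<close>
lemma pascal_hyp_even:
  "pascal_hyp (2 * m) x = (\<Sum>k\<le>m. pascal_coeff m k * x ^ k)"
proof -
  have "pochhammer (- of_nat m) k * pochhammer (of_nat (2 * m) / 2 + 1) k /
      (pochhammer (- of_nat (2 * m)) k * fact k) = pascal_coeff m k" if "k \<le> m" for k
  proof -
    have neg: "pochhammer (- of_nat n) k = (-1) ^ k * fact k * (of_nat (n choose k) :: rat)" for n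
      using gbinomial_pochhammer[of "of_nat n :: rat" k]
      by (simp add: binomial_gbinomial flip: power_mult_distrib)
    have pos: "pochhammer (of_nat (2 * m) / 2 + 1) k = fact k * (of_nat ((m + k) choose k) :: rat)"
      using gbinomial_pochhammer'[of "of_nat (m + k) :: rat" k]
      by (simp add: binomial_gbinomial)
    have "(of_nat ((2 * m) choose k) :: rat) \<noteq> 0" using that by simp
    then show ?thesis unfolding neg pos pascal_coeff_def by (simp add: field_simps)
  qed
  then show ?thesis
    unfolding pascal_hyp_def hyp2F1_terminating_def by (intro sum.cong) auto
qed

text \<open>The denominator \<open>2m choose k\<close> is a unit modulo \<open>p\<close>, being congruent to \<open>(-1)\<^sup>k\<close>; its sign cancels
  the one in \<open>(m+k choose k) \<equiv> (-1)\<^sup>k (m choose k)\<close>.\<close>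
lemma
  assumes "prime p" "p = 2 * m + 1" "k \<le> m"
  shows p_integral_pascal_coeff: "p_integral p (pascal_coeff m k)"
    and pascal_coeff_cong: "rat_cong p (pascal_coeff m k) (of_int (int (m choose k) ^ 2))"
proof -
  define C where "C = (2 * m) choose k"
  have C: "[int C = (-1) ^ k] (mod int p)"
    using choose_pred_prime_cong[OF assms(1), of k] assms by (simp add: C_def)
  have cop: "coprime C p" "C \<noteq> 0"
  proof -
    have "\<not> int p dvd int C"
    proof
      assume "int p dvd int C"
      then have "int p dvd (-1) ^ k" using cong_dvd_iff[OF C] by simp
      then show False using prime_gt_1_nat[OF assms(1)] by (simp add: zdvd1_eq uminus_power_if split: if_splits)
    qed
    then show "coprime C p"
      using assms(1) by (metis of_nat_dvd_iff prime_imp_coprime coprime_commute)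
    show "C \<noteq> 0" using assms by (simp add: C_def)
  qed
  show "p_integral p (pascal_coeff m k)"
    unfolding pascal_coeff_def C_def[symmetric]
    by (rule p_integral_divide_nat[OF p_integral_of_nat cop])
  have "[int (m choose k) * int ((m + k) choose k) =
      int (m choose k) * ((-1) ^ k * int (m choose k))] (mod int p)"
    by (intro cong_mult cong_refl choose_half_cong assms)
  also have "[int (m choose k) * ((-1) ^ k * int (m choose k)) =
      int (m choose k) * (int C * int (m choose k))] (mod int p)"
    by (intro cong_mult cong_refl cong_sym[OF C])
  finally have "[int ((m choose k) * ((m + k) choose k)) = int (m choose k) ^ 2 * int C] (mod int p)"
    by (simp add: power2_eq_square mult_ac)
  from rat_cong_scale[OF rat_cong_of_int[OF this] p_integral_divide_nat[OF p_integral_1 cop]]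
  show "rat_cong p (pascal_coeff m k) (of_int (int (m choose k) ^ 2))"
    using cop(2) by (simp add: pascal_coeff_def C_def[symmetric])
qed

lemma pascal_hyp_cong:
  fixes z :: int
  assumes "prime p" "p = 2 * m + 1"
  shows "rat_cong p (pascal_hyp (2 * m) (of_int z)) (of_int (\<Sum>k\<le>m. int (m choose k) ^ 2 * z ^ k))"
proof -
  have "rat_cong p (\<Sum>k\<le>m. pascal_coeff m k * of_int z ^ k)
      (\<Sum>k\<le>m. of_int (int (m choose k) ^ 2) * of_int z ^ k)"
    by (intro rat_cong_sum rat_cong_scale pascal_coeff_cong assms p_integral_power p_integral_of_int) auto
  then show ?thesis by (simp add: pascal_hyp_even)
qed

text \<open>The right-hand side is free of denominators in \<open>z\<close>, so it can be reduced modulo \<open>p\<close> and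
  compared coefficientwise with the generating function.\<close>
lemma pascal_hyp_pfaff:
  assumes "z \<noteq> 1"
  shows "pascal_hyp (2 * m) (z / (z - 1)) * (1 - z) ^ m =
    (\<Sum>k\<le>m. pascal_coeff m k * ((- z) ^ k * (1 - z) ^ (m - k)))"
proof -
  have "(z / (z - 1)) ^ k * (1 - z) ^ m = (- z) ^ k * (1 - z) ^ (m - k)" if "k \<le> m" for k
  proof -
    have "z / (z - 1) = - z / (1 - z)"
      using assms by (simp add: divide_simps) (simp add: algebra_simps)
    then have "(z / (z - 1)) ^ k * (1 - z) ^ k = (- z) ^ k"
      using assms by (simp only: power_mult_distrib[symmetric]) simp
    moreover have "(1 - z) ^ m = (1 - z) ^ k * (1 - z) ^ (m - k)"
      using that by (simp flip: power_add)
    ultimately show ?thesis by (metis mult.assoc)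
  qed
  then show ?thesis unfolding pascal_hyp_even sum_distrib_right
    by (intro sum.cong refl) (simp only: mult.assoc atMost_iff)
qed

text \<open>A congruence form of Pfaff's transformation: modulo \<open>p\<close> the parameters of the series become
  \<open>1/2, 1/2; 1\<close>, and the transformed factor coincides with the original one.\<close>
lemma pascal_hyp_pfaff_cong:
  fixes z :: int
  assumes "prime p" "p = 2 * m + 1"
  shows "rat_cong p (\<Sum>k\<le>m. pascal_coeff m k * ((- of_int z) ^ k * (1 - of_int z) ^ (m - k)))
    (of_int (\<Sum>k\<le>m. int (m choose k) ^ 2 * z ^ k))"
proof -
  have "rat_cong p (\<Sum>k\<le>m. pascal_coeff m k * of_int ((- z) ^ k * (1 - z) ^ (m - k)))
      (\<Sum>k\<le>m. of_int (int (m choose k) ^ 2) * of_int ((- z) ^ k * (1 - z) ^ (m - k)))"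
    by (intro rat_cong_sum rat_cong_scale pascal_coeff_cong assms p_integral_of_int) auto
  also have "(\<Sum>k\<le>m. of_int (int (m choose k) ^ 2) * of_int ((- z) ^ k * (1 - z) ^ (m - k))) =
      (of_int (\<Sum>k\<le>m. int ((m choose k) * ((m + k) choose k)) * (- z) ^ k) :: rat)"
    using sum_binomial_squares_shift[of m "- z"]
    by (simp only: of_int_mult[symmetric] of_int_sum[symmetric] of_int_eq_iff mult.assoc
        uminus_add_conv_diff diff_conv_add_uminus)
  also have "rat_cong p \<dots> (of_int (\<Sum>k\<le>m. int (m choose k) ^ 2 * z ^ k))"
  proof (intro rat_cong_of_int cong_sum)
    fix k assume "k \<in> {..m}"
    then have "[int (m choose k) * int ((m + k) choose k) * (- z) ^ k =
        int (m choose k) * ((-1) ^ k * int (m choose k)) * (- z) ^ k] (mod int p)"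
      by (intro cong_mult cong_refl choose_half_cong assms) auto
    also have "int (m choose k) * ((-1) ^ k * int (m choose k)) * (- z) ^ k =
        int (m choose k) ^ 2 * ((-1) ^ k * (- z) ^ k)"
      by (simp add: power2_eq_square mult_ac)
    also have "(-1) ^ k * (- z) ^ k = z ^ k" by (simp flip: power_mult_distrib)
    finally show "[int ((m choose k) * ((m + k) choose k)) * (- z) ^ k =
        int (m choose k) ^ 2 * z ^ k] (mod int p)" by simp
  qed
  finally show ?thesis by simp
qed

section \<open>Polynomials with p-integral coefficients\<close>

definition p_integral_poly :: "nat \<Rightarrow> rat poly \<Rightarrow> bool" where
  "p_integral_poly p P \<longleftrightarrow> (\<forall>i. p_integral p (Polynomial.coeff P i))"

lemma p_integral_poly_mult: "p_integral_poly p P \<Longrightarrow> p_integral_poly p Q \<Longrightarrow> p_integral_poly p (P * Q)"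
  unfolding p_integral_poly_def coeff_mult by blast

lemma p_integral_poly_power: "p_integral_poly p P \<Longrightarrow> p_integral_poly p (P ^ n)"
  by (induction n) (simp_all add: p_integral_poly_mult, simp add: p_integral_poly_def coeff_pCons split: nat.split)

lemma p_integral_poly_sum:
  "(\<And>i. i \<in> A \<Longrightarrow> p_integral_poly p (f i)) \<Longrightarrow> p_integral_poly p (sum f A)"
  unfolding p_integral_poly_def coeff_sum by blast

lemma p_integral_poly_smult: "p_integral p c \<Longrightarrow> p_integral_poly p P \<Longrightarrow> p_integral_poly p (Polynomial.smult c P)"
  unfolding p_integral_poly_def by auto

lemma p_integral_poly_linear: "p_integral_poly p [:of_int a, of_int b:]"
  unfolding p_integral_poly_def by (auto simp: coeff_pCons split: nat.split)

section \<open>The generating function and the Legendre curve\<close>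

theorem theoremC:
  fixes p N :: nat and v :: "rat vec"
  assumes "prime p" and "odd p" and "N = p - 1"
    and "eigenvector (sym_pascal N) v 1"
    and "v $ N = 1"
    and "\<And>z :: rat. z \<noteq> 1 \<Longrightarrow>
      gen_fun N v z = pascal_hyp N z * pascal_hyp N (z / (z - 1)) * (1 - z) ^ (N div 2)"
  shows "(\<forall>k\<le>N. p_integral p (v $ k)) \<and>
    (\<forall>z :: int. \<not> [z = 0] (mod int p) \<longrightarrow> \<not> [z = 1] (mod int p) \<longrightarrow>
      rat_cong p (gen_fun N v (of_int z)) ((of_nat (card (legendre_points p z)) - 1) ^ 2))"
proof -
  obtain m where p: "p = 2 * m + 1" using assms(2) by (elim oddE)
  have N: "N = 2 * m" using assms(3) p by simp
  define G where "G z = (\<Sum>k\<le>m. pascal_coeff m k * ((- z) ^ k * (1 - z) ^ (m - k)))" for z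
  have gen: "gen_fun N v z = pascal_hyp (2 * m) z * G z" if "z \<noteq> 1" for z
    using assms(6)[OF that] pascal_hyp_pfaff[OF that, of m] by (simp add: N G_def)
  have "p_integral p (v $ k)" if "k \<le> N" for k
  proof -
    define V where "V = (\<Sum>k\<le>N. Polynomial.monom (v $ k) (N - k))"
    define P where "P = (\<Sum>k\<le>m. Polynomial.smult (pascal_coeff m k) ([:0, 1:] ^ k))"
    define Q where "Q = (\<Sum>k\<le>m. Polynomial.smult (pascal_coeff m k) ([:0, -1:] ^ k * [:1, -1:] ^ (m - k)))"
    have "poly V z = poly (P * Q) z" if "z \<noteq> 1" for z
      using gen[OF that]
      by (simp add: V_def P_def Q_def G_def gen_fun_def pascal_hyp_even poly_sum poly_monom)
    \<comment> \<open>The hypothesis excludes only \<open>z = 1\<close>, so the two polynomials agree on an infinite set.\<close>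
    then have "- {1} \<subseteq> {z. poly (V - P * Q) z = 0}" by auto
    then have "infinite {z. poly (V - P * Q) z = 0}"
      using infinite_UNIV_char_0[where 'a = rat] by (metis finite_subset finite_compl finite.intros)
    then have "V = P * Q" using poly_roots_finite[of "V - P * Q"] by auto
    moreover have "p_integral_poly p (P * Q)"
      unfolding P_def Q_def
      using p_integral_poly_linear[of p 0 1] p_integral_poly_linear[of p 0 "-1"]
        p_integral_poly_linear[of p 1 "-1"]
      by (intro p_integral_poly_mult p_integral_poly_sum p_integral_poly_smult p_integral_poly_power
          p_integral_pascal_coeff[OF assms(1) p]) auto
    moreover have "Polynomial.coeff V (N - k) = v $ k"
    proof -
      have "Polynomial.coeff V (N - k) = (\<Sum>j\<le>N. if j = k then v $ j else 0)"
        unfolding V_def coeff_sum using that by (intro sum.cong) auto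
      then show ?thesis using that by simp
    qed
    ultimately show ?thesis unfolding p_integral_poly_def by metis
  qed
  moreover have "rat_cong p (gen_fun N v (of_int z)) ((of_nat (card (legendre_points p z)) - 1) ^ 2)"
    if "\<not> [z = 1] (mod int p)" for z :: int
  proof -
    define h where "h = (\<Sum>k\<le>m. int (m choose k) ^ 2 * z ^ k)"
    have H: "rat_cong p (pascal_hyp (2 * m) (of_int z)) (of_int h)"
      unfolding h_def by (rule pascal_hyp_cong[OF assms(1) p])
    have G: "rat_cong p (G (of_int z)) (of_int h)"
      unfolding h_def G_def by (rule pascal_hyp_pfaff_cong[OF assms(1) p])
    have "p_integral p (1 - of_int z)"
      using p_integral_of_int[of p "1 - z"] by simp
    then have "p_integral p (G (of_int z))"
      unfolding G_def by (intro p_integral_sum p_integral_mult p_integral_power p_integral_uminus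
          p_integral_of_int p_integral_pascal_coeff[OF assms(1) p]) auto
    then have HG: "rat_cong p (pascal_hyp (2 * m) (of_int z) * G (of_int z)) (of_int h * of_int h)"
      by (intro rat_cong_mult H G p_integral_of_int)
    have "of_int z \<noteq> (1 :: rat)" using that by auto
    then have "rat_cong p (gen_fun N v (of_int z)) (of_int (h ^ 2))"
      using gen HG by (simp add: power2_eq_square)
    also have "rat_cong p \<dots> (of_int ((int (card (legendre_points p z)) - 1) ^ 2))"
    proof (rule rat_cong_of_int)
      have "[(int (card (legendre_points p z)) - 1) ^ 2 = (- ((-1) ^ m * h)) ^ 2] (mod int p)"
        unfolding h_def by (intro cong_pow card_legendre_points_cong assms(1) p)
      also have "(- ((-1) ^ m * h)) ^ 2 = h ^ 2"
        by (simp add: power_mult_distrib flip: power_mult)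
      finally show "[h ^ 2 = (int (card (legendre_points p z)) - 1) ^ 2] (mod int p)"
        by (rule cong_sym)
    qed
    finally show ?thesis by simp
  qed
  ultimately show ?thesis by blast
qed

end
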